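(* For all integers $n\ge 0$, $$\overline{R_{2,3}}(9n+6)\equiv 0 \pmod 6.$$
   Context: An overpartition of a nonnegative integer $n$ is a partition of $n$ (a non-increasing sequence of positive integers summing to $n$) in which the first occurrence of each part size may be overlined. For coprime positive integers $\ell,\mu$, $\overline{R_{\ell,\mu}}(n)$ denotes the number of overpartitions of $n$ in which no part is divisible by $\ell$ or by $\mu$ (with $\overline{R_{\ell,\mu}}(0)=1$). Its generating function, for $|q|<1$, is $$\sum_{n\ge 0}\overline{R_{\ell,\mu}}(n)q^n=\prod_{n=1}^{\infty}\frac{(1+q^{n})(1-q^{\ell n})(1-q^{\mu n})(1+q^{\ell\mu n})}{(1-q^{n})(1+q^{\ell n})(1+q^{\mu n})(1-q^{\ell\mu n})}.$$ The claim concerns $(\ell,\mu)=(2,3)$. *)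

theory Defs
  imports "HOL-Number_Theory.Number_Theory"
begin

text \<open>
  An overpartition is a list of parts in non-increasing order, each part carrying a flag that says
  whether it is overlined; only the first occurrence of a part size may be overlined.
\<close>

definition is_overpartition :: "(nat \<times> bool) list \<Rightarrow> nat \<Rightarrow> bool" where
  "is_overpartition ps n \<longleftrightarrow>
     sorted_wrt (\<ge>) (map fst ps) \<and>
     (\<forall>a \<in> set (map fst ps). a > 0) \<and>
     sum_list (map fst ps) = n \<and>
     (\<forall>i < length ps. snd (ps ! i) \<longrightarrow> (\<forall>j < i. fst (ps ! j) \<noteq> fst (ps ! i)))"

definition overpartitions_R :: "nat \<Rightarrow> nat \<Rightarrow> nat \<Rightarrow> (nat \<times> bool) list set" where
  "overpartitions_R l m n =
     {ps. is_overpartition ps n \<and> (\<forall>a \<in> set (map fst ps). \<not> l dvd a \<and> \<not> m dvd a)}"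

definition Rbar :: "nat \<Rightarrow> nat \<Rightarrow> nat \<Rightarrow> nat" where
  "Rbar l m n = card (overpartitions_R l m n)"

text \<open>
  The sets being counted are finite, so \<^const>\<open>card\<close> is the genuine number of elements.
\<close>

lemma finite_overpartitions_R: "finite (overpartitions_R l m n)"
proof (rule finite_subset)
  have len: "length xs \<le> sum_list xs" if "\<forall>a \<in> set xs. a > 0" for xs :: "nat list"
    using that by (induction xs) auto
  show "overpartitions_R l m n \<subseteq> {ps. set ps \<subseteq> {..n} \<times> UNIV \<and> length ps \<le> n}"
  proof
    fix ps assume "ps \<in> overpartitions_R l m n"
    then have pos: "\<forall>a \<in> set (map fst ps). a > 0" and s: "sum_list (map fst ps) = n"
      by (auto simp: overpartitions_R_def is_overpartition_def)
    have "length ps \<le> n" using len[OF pos] s by simp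
    moreover have "fst p \<le> n" if "p \<in> set ps" for p
      using member_le_sum_list[of "fst p" "map fst ps"] that s by auto
    ultimately show "ps \<in> {ps. set ps \<subseteq> {..n} \<times> UNIV \<and> length ps \<le> n}"
      by (auto simp: mem_Times_iff)
  qed
  show "finite {ps. set ps \<subseteq> {..n} \<times> (UNIV :: bool set) \<and> length ps \<le> n}"
    by (rule finite_lists_length_le) simp
qed

lemma Rbar_0: "Rbar l m 0 = 1"
proof -
  have "overpartitions_R l m 0 = {[]}"
  proof -
    have "ps = []" if "is_overpartition ps 0" for ps
      using that by (cases ps) (auto simp: is_overpartition_def)
    then show ?thesis
      by (auto simp: overpartitions_R_def is_overpartition_def)
  qed
  then show ?thesis by (simp add: Rbar_def)
qed

end

theory Submission
  imports Defs "HOL-Computational_Algebra.Formal_Power_Series"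
begin

text \<open>
  Evenness holds for every \<open>n > 0\<close>: overlining or not overlining the largest part pairs off the
  overpartitions (\<open>even_Rbar\<close>). The substance is divisibility by 3, proved by computing with power
  series over the field with three elements, where \<open>f(q)\<^sup>3 = f(q\<^sup>3)\<close>.

  Write \<open>u = \<Sum>q\<^bsup>k\<^sup>2\<^esup>\<close> and \<open>v = \<Sum>(-1)\<^sup>kq\<^bsup>k\<^sup>2\<^esup>\<close>, both sums over all integers \<open>k\<close>. An identity of Gauss
  says \<open>v = \<Prod>(1 - q\<^sup>k)/(1 + q\<^sup>k)\<close>, so inclusion and exclusion over the multiples of 2 and 3 turns
  the generating function \<open>G\<close> of the overpartitions into \<open>v(q\<^sup>2)v(q\<^sup>3)/(v(q)v(q\<^sup>6))\<close>. Modulo 3 this is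
  \<open>v(q)\<^sup>2/v(q\<^sup>2)\<^sup>2\<close>, and since \<open>u(q)v(q) = v(q\<^sup>2)\<^sup>2\<close> it collapses to \<open>G = v/u\<close>.

  A square is 0 or 1 modulo 3, and the squares divisible by 3 are the numbers \<open>9k\<^sup>2\<close>. Hence, modulo 3,
  \<open>u = u\<^sup>9 + q a\<^sup>3\<close> and \<open>v = v\<^sup>9 + q b\<^sup>3\<close> for some series \<open>a\<close> and \<open>b\<close>. With these two equations the
  part of \<open>v/u\<close> with exponents \<open>9n + 6\<close> is a rational expression in \<open>u\<close>, \<open>v\<close>, \<open>a\<close>, \<open>b\<close>, and it
  vanishes as soon as \<open>a u = - b v\<close> (\<open>sections_of_quotient_eq_0\<close>).

  Cubing that relation and eliminating \<open>a\<close> and \<open>b\<close> leaves \<open>s\<^sup>3 = s\<close> for \<open>s = u\<^sup>4 + v\<^sup>4\<close>, so it is enough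
  that \<open>s\<close> is constant modulo 3. In other words, the number of representations of a positive even number
  as a sum of four squares is divisible by 3. This follows from the two classical
  relations \<open>u\<^sup>2 + v\<^sup>2 = 2 u(q\<^sup>2)\<^sup>2\<close> and \<open>u v = v(q\<^sup>2)\<^sup>2\<close>: modulo 3 they give \<open>s(q) = s(q\<^sup>2)\<close>, which
  only a constant series satisfies (\<open>theta_4_add_alt_theta_4\<close>).
\<close>

unbundle fps_syntax

section \<open>Counting overpartitions by the largest admitted part\<close>

lemma overpartitions_R_Cons:
  "(a, b) # ps \<in> overpartitions_R l m n \<longleftrightarrow>
     0 < a \<and> a \<le> n \<and> \<not> l dvd a \<and> \<not> m dvd a \<and> ps \<in> overpartitions_R l m (n - a) \<and>
     (\<forall>p\<in>set ps. fst p \<le> a) \<and> (a, True) \<notin> set ps"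
proof -
  have flags: "(\<forall>i < length ((a, b) # ps). snd (((a, b) # ps) ! i) \<longrightarrow>
          (\<forall>j < i. fst (((a, b) # ps) ! j) \<noteq> fst (((a, b) # ps) ! i)))
      \<longleftrightarrow> (a, True) \<notin> set ps \<and>
          (\<forall>i < length ps. snd (ps ! i) \<longrightarrow> (\<forall>j < i. fst (ps ! j) \<noteq> fst (ps ! i)))"
    unfolding in_set_conv_nth
    by (simp add: All_less_Suc2 del: all_simps) (auto simp: prod_eq_iff)
  show ?thesis
    unfolding overpartitions_R_def is_overpartition_def mem_Collect_eq flags
    by auto
qed

definition parts_upto :: "nat \<Rightarrow> nat \<Rightarrow> nat \<Rightarrow> nat \<Rightarrow> (nat \<times> bool) list set" where
  "parts_upto l m k n = {ps \<in> overpartitions_R l m n. \<forall>p\<in>set ps. fst p \<le> k}"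

text \<open>
  These are the tails of overpartitions with largest part \<open>k\<close>: once the first \<open>k\<close> has been removed,
  no later \<open>k\<close> may be overlined.
\<close>

definition parts_upto_plain :: "nat \<Rightarrow> nat \<Rightarrow> nat \<Rightarrow> nat \<Rightarrow> (nat \<times> bool) list set" where
  "parts_upto_plain l m k n = {ps \<in> parts_upto l m k n. (k, True) \<notin> set ps}"

lemma finite_parts_upto: "finite (parts_upto l m k n)" "finite (parts_upto_plain l m k n)"
  by (auto simp: parts_upto_def parts_upto_plain_def finite_overpartitions_R)

lemma parts_upto_0: "parts_upto l m 0 n = (if n = 0 then {[]} else {})"
proof -
  have "ps = [] \<and> n = 0" if "ps \<in> parts_upto l m 0 n" for ps
    using that by (cases ps)
      (auto simp: parts_upto_def overpartitions_R_Cons overpartitions_R_def is_overpartition_def)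
  moreover have "[] \<in> parts_upto l m 0 0"
    by (auto simp: parts_upto_def overpartitions_R_def is_overpartition_def)
  ultimately show ?thesis by (auto split: if_splits)
qed

lemma parts_upto_eq_overpartitions_R:
  assumes "n \<le> k" shows "parts_upto l m k n = overpartitions_R l m n"
proof -
  have "fst p \<le> k" if "ps \<in> overpartitions_R l m n" "p \<in> set ps" for ps p
    using that member_le_sum_list[of "fst p" "map fst ps"] assms
    by (fastforce simp: overpartitions_R_def is_overpartition_def)
  then show ?thesis by (auto simp: parts_upto_def)
qed

lemma Cons_in_parts_upto:
  "(k, b) # ps \<in> parts_upto l m k n \<longleftrightarrow>
     0 < k \<and> k \<le> n \<and> \<not> l dvd k \<and> \<not> m dvd k \<and> ps \<in> parts_upto_plain l m k (n - k)"
  by (auto simp: parts_upto_def parts_upto_plain_def overpartitions_R_Cons)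

text \<open>
  The parts are in non-increasing order, so a part \<open>Suc k\<close> shows up at the head or not at all.
\<close>

lemma parts_upto_Suc_cases:
  "ps \<in> parts_upto l m (Suc k) n \<longleftrightarrow>
     ps \<in> parts_upto l m k n \<or> ps \<in> parts_upto l m (Suc k) n \<and> (\<exists>b qs. ps = (Suc k, b) # qs)"
proof (cases ps)
  case (Cons p qs)
  obtain a b where p: "p = (a, b)" by (cases p)
  show ?thesis unfolding Cons p
    by (auto simp: parts_upto_def overpartitions_R_Cons le_Suc_eq)
qed (auto simp: parts_upto_def)

lemma parts_upto_Suc_not_allowed:
  assumes "l dvd Suc k \<or> m dvd Suc k"
  shows "parts_upto l m (Suc k) n = parts_upto l m k n"
proof (rule Set.set_eqI)
  fix ps show "ps \<in> parts_upto l m (Suc k) n \<longleftrightarrow> ps \<in> parts_upto l m k n"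
    using assms by (subst parts_upto_Suc_cases) (auto simp: Cons_in_parts_upto)
qed

lemma parts_upto_Suc_allowed:
  assumes "\<not> l dvd Suc k" "\<not> m dvd Suc k"
  shows "parts_upto l m (Suc k) n = parts_upto l m k n \<union>
           (if Suc k \<le> n then (\<lambda>(b, qs). (Suc k, b) # qs) ` (UNIV \<times> parts_upto_plain l m (Suc k) (n - Suc k))
            else {})"
  (is "?L = ?R")
proof (rule Set.set_eqI)
  fix ps show "ps \<in> ?L \<longleftrightarrow> ps \<in> ?R"
    using assms by (subst parts_upto_Suc_cases) (auto simp: Cons_in_parts_upto image_iff)
qed

lemma parts_upto_plain_Suc:
  assumes "\<not> l dvd Suc k" "\<not> m dvd Suc k"
  shows "parts_upto_plain l m (Suc k) n = parts_upto l m k n \<union>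
           (if Suc k \<le> n then Cons (Suc k, False) ` parts_upto_plain l m (Suc k) (n - Suc k) else {})"
  (is "?L = ?R")
proof (rule Set.set_eqI)
  fix ps
  have "ps \<in> ?L \<longleftrightarrow> (ps \<in> parts_upto l m k n \<or>
      (\<exists>b qs. ps = (Suc k, b) # qs \<and> Suc k \<le> n \<and> qs \<in> parts_upto_plain l m (Suc k) (n - Suc k)))
       \<and> (Suc k, True) \<notin> set ps"
    unfolding parts_upto_plain_def[of _ _ _ n] mem_Collect_eq
    by (subst parts_upto_Suc_cases) (use assms in \<open>auto simp: Cons_in_parts_upto\<close>)
  also have "\<dots> \<longleftrightarrow> ps \<in> ?R"
    by (auto simp: parts_upto_plain_def) (auto simp: parts_upto_def)
  finally show "ps \<in> ?L \<longleftrightarrow> ps \<in> ?R" .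
qed

lemma Suc_head_notin_parts_upto: "(Suc k, b) # qs \<notin> parts_upto l m k n"
  by (auto simp: parts_upto_def)

text \<open>
  The factor 2 is the free choice of overlining the first of the largest parts.
\<close>

lemma card_parts_upto_Suc:
  assumes "\<not> l dvd Suc k" "\<not> m dvd Suc k"
  shows "card (parts_upto l m (Suc k) n) = card (parts_upto l m k n) +
           (if Suc k \<le> n then 2 * card (parts_upto_plain l m (Suc k) (n - Suc k)) else 0)"
proof -
  let ?T = "parts_upto_plain l m (Suc k) (n - Suc k)"
  have "card ((\<lambda>(b, qs). (Suc k, b) # qs) ` ((UNIV::bool set) \<times> ?T)) = 2 * card ?T"
    by (subst card_image) (auto simp: inj_on_def card_cartesian_product)
  moreover have "parts_upto l m k n \<inter> (\<lambda>(b, qs). (Suc k, b) # qs) ` (UNIV \<times> ?T) = {}"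
    by (auto simp: Suc_head_notin_parts_upto)
  ultimately show ?thesis
    by (simp add: parts_upto_Suc_allowed[OF assms] card_Un_disjoint finite_parts_upto)
qed

lemma card_parts_upto_plain_Suc:
  assumes "\<not> l dvd Suc k" "\<not> m dvd Suc k"
  shows "card (parts_upto_plain l m (Suc k) n) = card (parts_upto l m k n) +
           (if Suc k \<le> n then card (parts_upto_plain l m (Suc k) (n - Suc k)) else 0)"
proof -
  let ?T = "parts_upto_plain l m (Suc k) (n - Suc k)"
  have "parts_upto l m k n \<inter> Cons (Suc k, False) ` ?T = {}"
    by (auto simp: Suc_head_notin_parts_upto)
  then show ?thesis
    by (subst parts_upto_plain_Suc[OF assms])
       (simp add: card_Un_disjoint finite_parts_upto card_image)
qed

lemma even_card_parts_upto: "0 < n \<Longrightarrow> even (card (parts_upto l m k n))"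
proof (induction k)
  case (Suc k)
  then show ?case
    by (cases "l dvd Suc k \<or> m dvd Suc k")
       (simp_all add: parts_upto_Suc_not_allowed card_parts_upto_Suc)
qed (simp add: parts_upto_0)

lemma even_Rbar: "0 < n \<Longrightarrow> even (Rbar l m n)"
  using even_card_parts_upto[of n l m n] by (simp add: Rbar_def parts_upto_eq_overpartitions_R)

definition parts_upto_fps :: "nat \<Rightarrow> nat \<Rightarrow> nat \<Rightarrow> 'a::comm_ring_1 fps" where
  "parts_upto_fps l m k = Abs_fps (\<lambda>n. of_nat (card (parts_upto l m k n)))"

text \<open>
  With \<open>T\<close> the series of the tails, the two recursions read \<open>C' = C + 2q\<^sup>kT\<close> and \<open>T = C + q\<^sup>kT\<close>.
  Eliminating \<open>T\<close> shows that admitting the part size \<open>k\<close> multiplies the series by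
  \<open>(1 + q\<^sup>k)/(1 - q\<^sup>k)\<close>.
\<close>

lemma parts_upto_fps_Suc:
  assumes "\<not> l dvd Suc k" "\<not> m dvd Suc k"
  shows "parts_upto_fps l m (Suc k) * (1 - fps_X ^ Suc k) =
           (parts_upto_fps l m k * (1 + fps_X ^ Suc k) :: 'a::comm_ring_1 fps)"
proof -
  define T :: "'a fps" where "T = Abs_fps (\<lambda>n. of_nat (card (parts_upto_plain l m (Suc k) n)))"
  have 1: "parts_upto_fps l m (Suc k) = parts_upto_fps l m k + 2 * (fps_X ^ Suc k * T)"
    by (rule fps_ext)
       (simp add: parts_upto_fps_def T_def card_parts_upto_Suc[OF assms] fps_X_power_mult_nth
         numeral_fps_const del: power_Suc)
  have 2: "T = parts_upto_fps l m k + fps_X ^ Suc k * T"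
    unfolding T_def parts_upto_fps_def
    by (rule fps_ext, subst fps_nth_Abs_fps, subst card_parts_upto_plain_Suc[OF assms])
       (simp add: fps_X_power_mult_nth del: power_Suc)
  have "parts_upto_fps l m k = T * (1 - fps_X ^ Suc k)"
    using 2 by (simp add: algebra_simps del: power_Suc)
  then show ?thesis unfolding 1
    by (simp only:) (simp add: algebra_simps del: power_Suc)
qed

section \<open>The field with three elements\<close>

text \<open>
  Working over an actual field, instead of with congruences between integer series, makes the power
  series an integral domain in which units can be inverted and equations can be divided by
  nonzero series.
\<close>

datatype gf3 = F0 | F1 | F2

instantiation gf3 :: field
begin
definition "zero_gf3 = F0"
definition "one_gf3 = F1"
definition "uminus_gf3 x = (case x of F0 \<Rightarrow> F0 | F1 \<Rightarrow> F2 | F2 \<Rightarrow> F1)"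
definition "plus_gf3 x y = (case x of F0 \<Rightarrow> y
   | F1 \<Rightarrow> (case y of F0 \<Rightarrow> F1 | F1 \<Rightarrow> F2 | F2 \<Rightarrow> F0)
   | F2 \<Rightarrow> (case y of F0 \<Rightarrow> F2 | F1 \<Rightarrow> F0 | F2 \<Rightarrow> F1))"
definition "times_gf3 x y = (case x of F0 \<Rightarrow> F0 | F1 \<Rightarrow> y | F2 \<Rightarrow> - y)" for y :: gf3
definition "minus_gf3 x y = x + - y" for x y :: gf3
definition "inverse_gf3 x = x" for x :: gf3
definition "divide_gf3 x y = x * y" for x y :: gf3
instance
proof
  fix a b c :: gf3
  note d = zero_gf3_def one_gf3_def uminus_gf3_def plus_gf3_def times_gf3_def minus_gf3_def
    inverse_gf3_def divide_gf3_def
  show "a + b + c = a + (b + c)" "a * b * c = a * (b * c)" "(a + b) * c = a * c + b * c"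
    by (cases a; cases b; cases c; simp add: d)+
  show "a + b = b + a" "a * b = b * a" "a - b = a + - b" "divide a b = a * inverse b"
    by (cases a; cases b; simp add: d)+
  show "0 + a = a" "- a + a = 0" "1 * a = a" "a \<noteq> 0 \<Longrightarrow> inverse a * a = 1"
    by (cases a; simp add: d)+
  show "(0::gf3) \<noteq> 1" "inverse (0::gf3) = 0" by (simp_all add: d)
qed
end

lemma gf3_three: "(3::gf3) = 0"
proof -
  have "(3::gf3) = 1 + 1 + 1" by simp
  also have "\<dots> = 0" by (simp only: one_gf3_def plus_gf3_def zero_gf3_def gf3.case)
  finally show ?thesis .
qed

lemma gf3_cube: "(x::gf3) ^ 3 = x"
  by (cases x; simp add: power3_eq_cube times_gf3_def uminus_gf3_def)

lemma of_nat_gf3_eq_0_iff: "(of_nat n :: gf3) = 0 \<longleftrightarrow> 3 dvd n"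
proof -
  have "n = 3 * (n div 3) + n mod 3" by simp
  then have "(of_nat n :: gf3) = 3 * of_nat (n div 3) + of_nat (n mod 3)"
    by (metis of_nat_add of_nat_mult of_nat_numeral)
  then have "(of_nat n :: gf3) = of_nat (n mod 3)" by (simp add: gf3_three)
  moreover have "n mod 3 = 0 \<or> n mod 3 = 1 \<or> n mod 3 = 2" by auto
  moreover have "(2::gf3) \<noteq> 0"
    using gf3_three by (metis add_cancel_left_left numeral_plus_one one_neq_zero semiring_norm(5))
  ultimately show ?thesis by (auto simp: dvd_eq_mod_eq_0)
qed

section \<open>Theta series and the identity of Gauss\<close>

lemma fps_nth_compose_X_power:
  fixes f :: "'a::comm_ring_1 fps"
  assumes "0 < m"
  shows "(f oo fps_X ^ m) $ n = (if m dvd n then f $ (n div m) else 0)"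
proof -
  have "(f oo fps_X ^ m) $ n = (\<Sum>i\<in>{0..n}. if n = m * i then f $ i else 0)"
    by (simp add: fps_compose_nth fps_X_power_nth flip: power_mult) (rule sum.cong; simp)
  also have "\<dots> = (\<Sum>i\<in>{0..n} \<inter> {i. n = m * i}. f $ i)" by (simp add: sum.inter_restrict)
  also have "{0..n} \<inter> {i. n = m * i} = (if m dvd n then {n div m} else {})" using assms by auto
  finally show ?thesis by simp
qed

text \<open>
  The classical series \<open>\<phi>(q) = \<Sum>q\<^bsup>k\<^sup>2\<^esup>\<close> over all integers \<open>k\<close>, often written \<open>\<theta>\<^sub>3\<close>. Counting
  integer roots gives the coefficient 1 at 0 and 2 at the positive squares.
\<close>

definition theta :: "'a::comm_ring_1 fps" where
  "theta = Abs_fps (\<lambda>n. of_nat (card {x::int. x\<^sup>2 = int n}))"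

text \<open>
  The series \<open>\<phi>(-q)\<close>. The sign \<open>(-1)\<^sup>n\<close> agrees with the usual \<open>(-1)\<^sup>k\<close> at \<open>n = k\<^sup>2\<close>, as \<open>k\<close> and \<open>k\<^sup>2\<close>
  have the same parity.
\<close>

definition alt_theta :: "'a::comm_ring_1 fps" where
  "alt_theta = Abs_fps (\<lambda>n. (-1) ^ n * theta $ n)"

lemma square_roots_int: "{x::int. x\<^sup>2 = int (k\<^sup>2)} = {int k, - int k}"
  by (auto simp: power2_eq_iff)

lemma theta_nth_square: "theta $ (k\<^sup>2) = (if k = 0 then 1 else 2)"
  by (simp add: theta_def square_roots_int del: of_nat_power)

lemma theta_nth_nonsquare:
  assumes "\<And>k. n \<noteq> k\<^sup>2" shows "theta $ n = 0"
proof -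
  have "x\<^sup>2 \<noteq> int n" for x
    using assms[of "nat \<bar>x\<bar>"] by (metis abs_ge_zero nat_eq_iff2 of_nat_eq_iff of_nat_power power2_abs)
  then show ?thesis by (simp add: theta_def)
qed

lemma alt_theta_nth_partial_sum:
  assumes "i \<le> n"
  shows "(alt_theta :: 'a::comm_ring_1 fps) $ i = (1 + 2 * (\<Sum>s=1..n. (-1) ^ s * fps_X ^ (s\<^sup>2))) $ i"
proof -
  have *: "(1 + 2 * (\<Sum>s=1..n. (-1) ^ s * fps_X ^ (s\<^sup>2)) :: 'a fps) $ i =
      (if i = 0 then 1 else 0) + 2 * (\<Sum>s=1..n. if i = s\<^sup>2 then (-1) ^ s else 0)"
  proof -
    have "((-1) ^ s * fps_X ^ (s\<^sup>2) :: 'a fps) $ i = (if i = s\<^sup>2 then (-1) ^ s else 0)" for s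
      by (cases "even s") auto
    then show ?thesis by (simp add: fps_sum_nth numeral_fps_const)
  qed
  show ?thesis
  proof (cases "\<exists>k. i = k\<^sup>2")
    case True
    then obtain k where k: "i = k\<^sup>2" by blast
    have "k \<le> n" using assms k by (metis le_square le_trans power2_eq_square)
    have "(\<Sum>s=1..n. if i = s\<^sup>2 then (-1) ^ s else 0) = (\<Sum>s\<in>{1..n}. if s = k then (-1) ^ k else (0::'a))"
      by (rule sum.cong) (auto simp: k)
    also have "\<dots> = (if k = 0 then 0 else (-1) ^ k)" using \<open>k \<le> n\<close> by (simp add: sum.delta)
    finally show ?thesis unfolding *
      by (auto simp: alt_theta_def k theta_nth_square)
         (simp_all add: minus_one_power_iff)
  next
    case False
    moreover have "i \<noteq> 0" using False by (metis zero_power2)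
    ultimately show ?thesis unfolding * by (auto simp: alt_theta_def theta_nth_nonsquare intro!: sum.neutral)
  qed
qed

text \<open>
  The factor \<open>r s\<close> extends the product to \<open>{s - 1<..m}\<close>, so the first half of each summand cancels the
  second half of its predecessor; at \<open>s = 0\<close> the first half is absent because \<open>r 0 = 0\<close>.
\<close>

lemma gauss_telescope:
  fixes x :: "'a::comm_ring_1" and r :: "nat \<Rightarrow> 'a"
  assumes r0: "r 0 = 0" and "j \<le> m"
  shows "(\<Sum>s\<le>j. (-1) ^ s * (\<Prod>k\<in>{s<..m}. r k) * (r s * x ^ s + x ^ Suc s)) =
           (-1) ^ j * (\<Prod>k\<in>{j<..m}. r k) * x ^ Suc j"
  using \<open>j \<le> m\<close>
proof (induction j)
  case (Suc j)
  have "{j<..m} = insert (Suc j) {Suc j<..m}" using Suc.prems by auto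
  then have "(\<Prod>k\<in>{j<..m}. r k) = r (Suc j) * (\<Prod>k\<in>{Suc j<..m}. r k)" by simp
  then show ?case using Suc by (simp add: algebra_simps)
qed (simp add: r0)

text \<open>
  A finite form of the identity of Gauss, in the style of Shanks. The hypotheses say
  \<open>r k = (1 - y\<^sup>k)/(1 + y\<^sup>k)\<close>. For a formal variable \<open>y\<close> only the summand \<open>s = 0\<close> on the left, the
  product of \<open>r 1\<close> up to \<open>r n\<close>, has terms of degree at most \<open>n\<close>, so as \<open>n\<close> grows the product becomes
  the theta series on the right. Going from \<open>n\<close> to \<open>n + 1\<close> changes the left side by exactly the new square
  term, after the telescoping above.
\<close>

lemma gauss_finite:
  fixes y :: "'a::idom" and r :: "nat \<Rightarrow> 'a"
  assumes r0: "r 0 = 0" and r: "\<And>k. r k * (1 + y ^ k) = 1 - y ^ k"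
    and nz: "\<And>k. 0 < k \<Longrightarrow> 1 + y ^ k \<noteq> 0"
  shows "(\<Sum>s\<le>n. (-1) ^ s * (1 + r s) * (\<Prod>k\<in>{s<..n}. r k) * y ^ (s * Suc n)) =
           1 + 2 * (\<Sum>s=1..n. (-1) ^ s * y ^ (s\<^sup>2))"
proof (induction n)
  case (Suc m)
  define x where "x = y ^ Suc m"
  define R where "R s = (\<Prod>k\<in>{s<..m}. r k)" for s
  define A where "A = (\<Sum>s\<le>m. (-1) ^ s * (1 + r s) * R s * x ^ s)"
  have A: "A = 1 + 2 * (\<Sum>s=1..m. (-1) ^ s * y ^ (s\<^sup>2))"
  proof -
    have "x ^ s = y ^ (s * Suc m)" for s by (simp only: x_def power_mult[symmetric] mult.commute)
    then show ?thesis using Suc.IH by (simp only: A_def R_def)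
  qed
  have rx: "r (Suc m) * (1 + x) = 1 - x" using r[of "Suc m"] by (simp add: x_def)
  have R_Suc: "(\<Prod>k\<in>{s<..Suc m}. r k) = r (Suc m) * R s" if "s \<le> m" for s
  proof -
    have "{s<..Suc m} = insert (Suc m) {s<..m}" using that by auto
    then show ?thesis by (simp add: R_def)
  qed
  have pow: "y ^ (s * Suc (Suc m)) = x ^ s * y ^ s" for s
    by (simp add: x_def power_add mult.commute flip: power_mult power_Suc)
  define A' where "A' = (\<Sum>s\<le>Suc m. (-1) ^ s * (1 + r s) * (\<Prod>k\<in>{s<..Suc m}. r k) * y ^ (s * Suc (Suc m)))"
  define S where "S = (\<Sum>s\<le>m. (-1) ^ s * (1 + r s) * (r (Suc m) * R s) * (x ^ s * y ^ s))"
  have A'_eq: "A' = S + (-1) ^ Suc m * (1 + r (Suc m)) * (x ^ Suc m * x)"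
    unfolding A'_def S_def by (simp only: sum.atMost_Suc pow) (simp add: R_Suc x_def)
  \<comment> \<open>Multiplying the recursion by \<open>1 + x\<close> clears the denominator of \<open>r (Suc m)\<close>.\<close>
  have "(1 + x) * A' = (1 + x) * S + (-1) ^ Suc m * ((1 + x) + r (Suc m) * (1 + x)) * (x ^ Suc m * x)"
    unfolding A'_eq by (simp add: algebra_simps)
  also have "(1 + x) * S = (\<Sum>s\<le>m. (-1) ^ s * (1 + r s) * R s * (x ^ s * y ^ s) * (r (Suc m) * (1 + x)))"
    unfolding S_def sum_distrib_left by (simp only: mult_ac)
  also have "(1 + x) + r (Suc m) * (1 + x) = 2" using rx by simp
  finally have 1: "(1 + x) * A' = (\<Sum>s\<le>m. (-1) ^ s * (1 + r s) * R s * (x ^ s * y ^ s) * (1 - x))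
      + (-1) ^ Suc m * 2 * (x ^ Suc m * x)"
    unfolding rx .
  have 2: "(-1) ^ s * (1 + r s) * R s * (x ^ s * y ^ s) * (1 - x) - (1 + x) * ((-1) ^ s * (1 + r s) * R s * x ^ s)
        = - 2 * ((-1) ^ s * R s * (r s * x ^ s + x ^ Suc s))" for s
  proof -
    have a: "(1 + r s) * (1 + y ^ s) = 2" using r[of s] by (simp add: algebra_simps)
    have b: "(1 + r s) * (1 - y ^ s) = 2 * r s" using r[of s] by (simp add: algebra_simps)
    have "(1 + r s) * (y ^ s * (1 - x) - (1 + x)) = - ((1 + r s) * (1 - y ^ s)) - x * ((1 + r s) * (1 + y ^ s))"
      by (simp add: algebra_simps)
    also have "\<dots> = - 2 * (r s + x)" unfolding a b by (simp add: algebra_simps)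
    finally have c: "(1 + r s) * (y ^ s * (1 - x) - (1 + x)) = - 2 * (r s + x)" .
    have "(-1) ^ s * (1 + r s) * R s * (x ^ s * y ^ s) * (1 - x) - (1 + x) * ((-1) ^ s * (1 + r s) * R s * x ^ s)
      = (-1) ^ s * R s * x ^ s * ((1 + r s) * (y ^ s * (1 - x) - (1 + x)))" by (simp add: algebra_simps)
    also have "\<dots> = - 2 * ((-1) ^ s * R s * (r s * x ^ s + x ^ Suc s))" unfolding c by (simp add: algebra_simps)
    finally show ?thesis .
  qed
  have "(\<Sum>s\<le>m. (-1) ^ s * (1 + r s) * R s * (x ^ s * y ^ s) * (1 - x)) - (1 + x) * A
      = - 2 * (\<Sum>s\<le>m. (-1) ^ s * R s * (r s * x ^ s + x ^ Suc s))"
    unfolding A_def sum_distrib_left sum_subtractf[symmetric] by (rule sum.cong[OF refl]) (rule 2)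
  also have "(\<Sum>s\<le>m. (-1) ^ s * R s * (r s * x ^ s + x ^ Suc s)) = (-1) ^ m * x ^ Suc m"
    using gauss_telescope[of r m m x] r0 by (simp add: R_def)
  finally have "(1 + x) * A' = (1 + x) * (A + 2 * (-1) ^ Suc m * x ^ Suc m)"
    unfolding 1 by (simp add: algebra_simps)
  moreover have "1 + x \<noteq> 0" using nz[of "Suc m"] by (simp add: x_def)
  ultimately have "A' = A + 2 * (-1) ^ Suc m * x ^ Suc m" by (metis mult_left_cancel)
  also have "x ^ Suc m = y ^ ((Suc m)\<^sup>2)" by (simp add: x_def power2_eq_square flip: power_mult power_Suc)
  also have "A + 2 * (-1) ^ Suc m * y ^ ((Suc m)\<^sup>2) = 1 + 2 * (\<Sum>s=1..Suc m. (-1) ^ s * y ^ (s\<^sup>2))"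
    by (simp add: A algebra_simps)
  finally show ?case unfolding A'_def .
qed (simp add: r0)

lemma one_plus_X_power_nonzero: "0 < k \<Longrightarrow> (1 + fps_X ^ k :: 'a::idom fps) \<noteq> 0"
proof
  assume "0 < k" "(1 + fps_X ^ k :: 'a fps) = 0"
  then have "(1 + fps_X ^ k :: 'a fps) $ 0 = 0" by simp
  then show False using \<open>0 < k\<close> by simp
qed

text \<open>
  At \<open>k = 0\<close> the value is 0, also in characteristic 2, so the telescoping may start there.
\<close>

definition gauss_factor :: "nat \<Rightarrow> 'a::field fps" where
  "gauss_factor k = (1 - fps_X ^ k) * inverse (1 + fps_X ^ k)"

lemma gauss_factor_0: "gauss_factor 0 = 0"
  by (simp add: gauss_factor_def)

lemma gauss_factor_mult: "gauss_factor k * (1 + fps_X ^ k) = 1 - fps_X ^ k"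
  by (cases "k = 0") (simp_all add: gauss_factor_def mult.assoc inverse_mult_eq_1)

text \<open>
  The infinite product of Gauss, stated through its partial products: a coefficient of index at most \<open>n\<close>
  sees only the first \<open>n\<close> factors.
\<close>

lemma alt_theta_nth_prod:
  assumes "i \<le> n"
  shows "(alt_theta :: 'a::field fps) $ i = (\<Prod>k\<in>{1..n}. gauss_factor k) $ i"
proof -
  let ?r = "gauss_factor :: nat \<Rightarrow> 'a fps"
  let ?t = "\<lambda>s. (-1) ^ s * (1 + ?r s) * (\<Prod>k\<in>{s<..n}. ?r k) * fps_X ^ (s * Suc n)"
  have "(alt_theta :: 'a fps) $ i = (\<Sum>s\<le>n. ?t s) $ i"
    unfolding alt_theta_nth_partial_sum[OF assms]
    by (subst gauss_finite) (auto simp: gauss_factor_0 gauss_factor_mult one_plus_X_power_nonzero)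
  also have "\<dots> = (\<Sum>s\<le>n. if s = 0 then ?t 0 $ i else 0)"
    unfolding fps_sum_nth
  proof (rule sum.cong)
    fix s
    have "i < s * Suc n" if "0 < s"
      using that assms by (cases s) auto
    then show "?t s $ i = (if s = 0 then ?t 0 $ i else 0)"
      by (simp add: fps_X_power_mult_right_nth)
  qed simp
  also have "\<dots> = (\<Prod>k\<in>{0<..n}. ?r k) $ i" by (simp add: gauss_factor_0)
  also have "{0<..n} = {1..n}" by auto
  finally show ?thesis .
qed

lemma gauss_factor_compose:
  assumes "0 < m" "0 < k"
  shows "gauss_factor k oo fps_X ^ m = gauss_factor (m * k)"
  using assms
  by (simp add: gauss_factor_def fps_compose_mult_distrib fps_compose_sub_distrib fps_compose_add_distrib
    fps_inverse_compose fps_X_power_compose flip: power_mult)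

lemma alt_theta_compose_nth_prod:
  assumes "0 < m" "i \<le> m * n"
  shows "((alt_theta :: 'a::field fps) oo fps_X ^ m) $ i = (\<Prod>k\<in>{1..n}. gauss_factor (m * k)) $ i"
proof -
  have "((alt_theta :: 'a fps) oo fps_X ^ m) $ i = ((\<Prod>k\<in>{1..n}. gauss_factor k) oo fps_X ^ m) $ i"
    using assms by (auto simp: fps_nth_compose_X_power alt_theta_nth_prod[of _ n])
  also have "(\<Prod>k\<in>{1..n}. gauss_factor k) oo fps_X ^ m = (\<Prod>k\<in>{1..n}. gauss_factor (m * k) :: 'a fps)"
    using assms by (simp add: fps_compose_prod_distrib gauss_factor_compose)
  finally show ?thesis .
qed

section \<open>The generating function as a quotient of theta series\<close>

lemma parts_upto_fps_mult_prod:
  "parts_upto_fps l m n * (\<Prod>k | k \<in> {1..n} \<and> \<not> l dvd k \<and> \<not> m dvd k. gauss_factor k) = (1 :: 'a::field fps)"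
proof (induction n)
  case 0
  show ?case by (simp add: parts_upto_fps_def parts_upto_0 fps_eq_iff)
next
  case (Suc n)
  let ?I = "\<lambda>n. {k \<in> {1..n}. \<not> l dvd k \<and> \<not> m dvd k}"
  show ?case
  proof (cases "l dvd Suc n \<or> m dvd Suc n")
    case True
    then have "?I (Suc n) = ?I n" by (auto simp: le_Suc_eq)
    then show ?thesis
      using Suc True by (simp add: parts_upto_fps_def parts_upto_Suc_not_allowed)
  next
    case False
    then have I: "?I (Suc n) = insert (Suc n) (?I n)" by (auto simp: le_Suc_eq)
    let ?C = "\<lambda>n. parts_upto_fps l m n :: 'a fps"
    have "?C (Suc n) * gauss_factor (Suc n) * (1 + fps_X ^ Suc n) = ?C n * (1 + fps_X ^ Suc n)"
      using False parts_upto_fps_Suc[of l n m]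
      by (simp add: mult.assoc gauss_factor_mult del: power_Suc)
    then have "?C (Suc n) * gauss_factor (Suc n) = ?C n"
      using one_plus_X_power_nonzero[of "Suc n"] by (metis mult_right_cancel zero_less_Suc)
    then show ?thesis using Suc unfolding I by (simp add: mult.assoc[symmetric])
  qed
qed

text \<open>
  The multiples of 2 and of 3 overlap in the multiples of 6, which must be compensated once. The upper bound
  \<open>6n\<close> makes all the index ranges end exactly.
\<close>

lemma prod_inclusion_exclusion_2_3:
  fixes r :: "nat \<Rightarrow> 'a::comm_monoid_mult"
  shows "(\<Prod>k\<in>{1..6 * n}. r k) * (\<Prod>k\<in>{1..n}. r (6 * k)) =
     (\<Prod>k\<in>{1..3 * n}. r (2 * k)) * (\<Prod>k\<in>{1..2 * n}. r (3 * k)) *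
     (\<Prod>k | k \<in> {1..6 * n} \<and> \<not> 2 dvd k \<and> \<not> 3 dvd k. r k)"
proof -
  define D where "D d = {k \<in> {1..6 * n}. d dvd k}" for d
  let ?A = "{k \<in> {1..6 * n}. \<not> 2 dvd k \<and> \<not> 3 dvd k}"
  have multiples: "(\<Prod>k\<in>D d. r k) = (\<Prod>k\<in>{1..e}. r (d * k))" if "d * e = 6 * n" "0 < d" for d e
  proof -
    have "D d = (*) d ` {1..e}"
      using that by (auto simp: D_def image_iff that(1)[symmetric] elim!: dvdE)
    then show ?thesis using that by (simp add: prod.reindex inj_on_def)
  qed
  have "D 2 \<inter> D 3 = D 6" by (auto simp: D_def)
  have "(\<Prod>k\<in>{1..6 * n}. r k) = (\<Prod>k\<in>?A. r k) * (\<Prod>k\<in>D 2 \<union> D 3. r k)"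
    by (subst prod.union_disjoint[symmetric]) (auto simp: D_def intro!: prod.cong)
  then have "(\<Prod>k\<in>{1..6 * n}. r k) * (\<Prod>k\<in>D 6. r k) =
      (\<Prod>k\<in>?A. r k) * ((\<Prod>k\<in>D 2 \<union> D 3. r k) * (\<Prod>k\<in>D 2 \<inter> D 3. r k))"
    by (simp only: \<open>D 2 \<inter> D 3 = D 6\<close> mult.assoc)
  also have "(\<Prod>k\<in>D 2 \<union> D 3. r k) * (\<Prod>k\<in>D 2 \<inter> D 3. r k) = (\<Prod>k\<in>D 2. r k) * (\<Prod>k\<in>D 3. r k)"
    by (rule prod.union_inter) (auto simp: D_def)
  finally show ?thesis
    by (simp add: multiples[of 6 n] multiples[of 2 "3 * n"] multiples[of 3 "2 * n"] mult_ac)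
qed

definition Rbar_fps :: "nat \<Rightarrow> nat \<Rightarrow> 'a::comm_ring_1 fps" where
  "Rbar_fps l m = Abs_fps (\<lambda>n. of_nat (Rbar l m n))"

lemma parts_upto_fps_nth: "i \<le> k \<Longrightarrow> parts_upto_fps l m k $ i = Rbar_fps l m $ i"
  by (simp add: parts_upto_fps_def Rbar_fps_def Rbar_def parts_upto_eq_overpartitions_R)

lemma fps_mult_nth_cong:
  assumes "\<And>i. i \<le> n \<Longrightarrow> f $ i = f' $ i" "\<And>i. i \<le> n \<Longrightarrow> g $ i = g' $ i" "i \<le> n"
  shows "(f * g) $ i = (f' * g') $ i"
  using assms by (auto simp: fps_mult_nth intro!: sum.cong)

text \<open>
  The quotient of theta series for the generating function, with denominators cleared. Each coefficient
  involves finitely many factors only, so the finite inclusion and exclusion suffices.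
\<close>

lemma Rbar_fps_2_3:
  "Rbar_fps 2 3 * (alt_theta * (alt_theta oo fps_X ^ 6)) =
     (alt_theta oo fps_X ^ 2) * ((alt_theta :: 'a::field fps) oo fps_X ^ 3)"
proof (rule fps_ext)
  fix n
  let ?r = "gauss_factor :: nat \<Rightarrow> 'a fps"
  let ?A = "\<Prod>k | k \<in> {1..6 * n} \<and> \<not> 2 dvd k \<and> \<not> 3 dvd k. ?r k"
  have "(Rbar_fps 2 3 * (alt_theta * (alt_theta oo fps_X ^ 6)) :: 'a fps) $ n =
      (parts_upto_fps 2 3 (6 * n) * ((\<Prod>k\<in>{1..6 * n}. ?r k) * (\<Prod>k\<in>{1..n}. ?r (6 * k)))) $ n"
    by (intro fps_mult_nth_cong[of n])
       (auto simp: parts_upto_fps_nth alt_theta_nth_prod[of _ "6 * n"] alt_theta_compose_nth_prod[of 6 _ n])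
  also have "parts_upto_fps 2 3 (6 * n) * ((\<Prod>k\<in>{1..6 * n}. ?r k) * (\<Prod>k\<in>{1..n}. ?r (6 * k))) =
      (\<Prod>k\<in>{1..3 * n}. ?r (2 * k)) * (\<Prod>k\<in>{1..2 * n}. ?r (3 * k)) * (parts_upto_fps 2 3 (6 * n) * ?A)"
    unfolding prod_inclusion_exclusion_2_3 by (simp only: mult_ac)
  also have "\<dots> = (\<Prod>k\<in>{1..3 * n}. ?r (2 * k)) * (\<Prod>k\<in>{1..2 * n}. ?r (3 * k))"
    unfolding parts_upto_fps_mult_prod by simp
  also have "\<dots> $ n = ((alt_theta oo fps_X ^ 2) * (alt_theta oo fps_X ^ 3)) $ n"
    by (intro fps_mult_nth_cong[of n])
       (auto simp: alt_theta_compose_nth_prod[of 2 _ "3 * n"] alt_theta_compose_nth_prod[of 3 _ "2 * n"])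
  finally show "(Rbar_fps 2 3 * (alt_theta * (alt_theta oo fps_X ^ 6))) $ n =
      ((alt_theta oo fps_X ^ 2) * ((alt_theta :: 'a fps) oo fps_X ^ 3)) $ n" .
qed

section \<open>Sums of two squares\<close>

text \<open>
  The rotation \<open>(x, y) \<mapsto> (x + y, x - y)\<close> doubles \<open>x\<^sup>2 + y\<^sup>2\<close>; it reaches every representation of an even
  number because there both entries have the same parity.
\<close>

lemma card_sum_of_two_squares_double:
  "card {(x::int, y::int). x\<^sup>2 + y\<^sup>2 = int (2 * m)} = card {(x::int, y::int). x\<^sup>2 + y\<^sup>2 = int m}"
proof (rule bij_betw_same_card[symmetric])
  show "bij_betw (\<lambda>(x, y). (x + y, x - y))
      {(x::int, y::int). x\<^sup>2 + y\<^sup>2 = int m} {(x::int, y::int). x\<^sup>2 + y\<^sup>2 = int (2 * m)}"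
  proof (rule bij_betw_imageI)
    show "inj_on (\<lambda>(x::int, y). (x + y, x - y)) {(x, y). x\<^sup>2 + y\<^sup>2 = int m}"
      by (auto simp: inj_on_def)
    show "(\<lambda>(x, y). (x + y, x - y)) ` {(x::int, y::int). x\<^sup>2 + y\<^sup>2 = int m} =
        {(x::int, y::int). x\<^sup>2 + y\<^sup>2 = int (2 * m)}"
    proof safe
      fix x y :: int assume "x\<^sup>2 + y\<^sup>2 = int m"
      then show "(x + y)\<^sup>2 + (x - y)\<^sup>2 = int (2 * m)" by (simp add: power2_eq_square algebra_simps)
    next
      fix x y :: int assume xy: "x\<^sup>2 + y\<^sup>2 = int (2 * m)"
      then have "even (x\<^sup>2 + y\<^sup>2)" by simp
      then have "even (x + y)" by simp
      then obtain s where s: "x + y = 2 * s" by (elim evenE)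
      define t where "t = s - y"
      have xy_eq: "x = s + t" "y = s - t" using s by (auto simp: t_def)
      have "x\<^sup>2 + y\<^sup>2 = 2 * (s\<^sup>2 + t\<^sup>2)"
        unfolding xy_eq by (simp add: power2_eq_square algebra_simps)
      then have "s\<^sup>2 + t\<^sup>2 = int m" using xy by simp
      then show "(x, y) \<in> (\<lambda>(x, y). (x + y, x - y)) ` {(x::int, y::int). x\<^sup>2 + y\<^sup>2 = int m}"
        by (intro image_eqI[of _ _ "(s, t)"]) (auto simp: xy_eq)
    qed
  qed
qed

lemma finite_square_roots_int: "finite {x::int. x\<^sup>2 = c}"
proof (rule finite_subset)
  show "{x::int. x\<^sup>2 = c} \<subseteq> {-\<bar>c\<bar>..\<bar>c\<bar>}"
  proof safe
    fix x :: int
    have "\<bar>x\<bar> * 1 \<le> \<bar>x\<bar> * \<bar>x\<bar>" if "x \<noteq> 0"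
      by (rule mult_left_mono) (use that in auto)
    then have "\<bar>x\<bar> \<le> x\<^sup>2" by (cases "x = 0") (auto simp: power2_eq_square)
    then show "x \<in> {-\<bar>x\<^sup>2\<bar>..\<bar>x\<^sup>2\<bar>}" by auto
  qed
qed simp

lemma theta_squared_nth:
  "(theta\<^sup>2 :: 'a::comm_ring_1 fps) $ n = of_nat (card {(x::int, y::int). x\<^sup>2 + y\<^sup>2 = int n})"
proof -
  let ?S = "\<lambda>i. {x::int. x\<^sup>2 = int i}"
  have "{(x::int, y::int). x\<^sup>2 + y\<^sup>2 = int n} = (\<Union>i\<in>{0..n}. ?S i \<times> ?S (n - i))"
  proof safe
    fix x y :: int assume xy: "x\<^sup>2 + y\<^sup>2 = int n"
    obtain i j where ij: "x\<^sup>2 = int i" "y\<^sup>2 = int j" by (metis zero_le_power2 nonneg_int_cases)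
    then have "n = i + j" using xy by simp
    then show "(x, y) \<in> (\<Union>i\<in>{0..n}. ?S i \<times> ?S (n - i))"
      using ij by (intro UN_I[of i]) auto
  qed auto
  then have "card {(x::int, y::int). x\<^sup>2 + y\<^sup>2 = int n} = (\<Sum>i=0..n. card (?S i \<times> ?S (n - i)))"
    by (simp only:, subst card_UN_disjoint) (auto simp: finite_square_roots_int)
  then show ?thesis
    unfolding power2_eq_square[of "theta :: 'a fps"] fps_mult_nth
    by (simp add: theta_def card_cartesian_product)
qed

lemma theta_squared_nth_double: "(theta\<^sup>2 :: 'a::comm_ring_1 fps) $ (2 * m) = theta\<^sup>2 $ m"
  by (simp only: theta_squared_nth card_sum_of_two_squares_double)

text \<open>
  The substitution \<open>q \<mapsto> -q\<close> is multiplicative.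
\<close>

lemma alternate_mult:
  fixes f g :: "'a::comm_ring_1 fps"
  shows "Abs_fps (\<lambda>n. (-1) ^ n * f $ n) * Abs_fps (\<lambda>n. (-1) ^ n * g $ n) =
         Abs_fps (\<lambda>n. (-1) ^ n * (f * g) $ n)"
proof (rule fps_ext)
  fix n
  have "(-1) ^ i * f $ i * ((-1) ^ (n - i) * g $ (n - i)) = (-1) ^ n * (f $ i * g $ (n - i))"
    if "i \<in> {0..n}" for i
  proof -
    have "(-1::'a) ^ n = (-1) ^ i * (-1) ^ (n - i)" using that by (simp flip: power_add)
    then show ?thesis by (simp add: algebra_simps)
  qed
  then show "(Abs_fps (\<lambda>n. (-1) ^ n * f $ n) * Abs_fps (\<lambda>n. (-1) ^ n * g $ n)) $ n =
      Abs_fps (\<lambda>n. (-1) ^ n * (f * g) $ n) $ n"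
    by (simp add: fps_mult_nth sum_distrib_left)
qed

lemma alt_theta_squared_nth: "(alt_theta\<^sup>2 :: 'a::comm_ring_1 fps) $ n = (-1) ^ n * theta\<^sup>2 $ n"
  by (simp add: power2_eq_square alt_theta_def alternate_mult)

text \<open>
  Adding the two squares keeps twice the even part of \<open>\<phi>(q)\<^sup>2\<close>, and doubling \<open>n\<close> does not change the number
  of representations by two squares.
\<close>

lemma theta_squared_add_alt_theta_squared:
  "theta\<^sup>2 + alt_theta\<^sup>2 = 2 * ((theta :: 'a::comm_ring_1 fps)\<^sup>2 oo fps_X ^ 2)"
proof (rule fps_ext)
  fix n show "(theta\<^sup>2 + alt_theta\<^sup>2 :: 'a fps) $ n = (2 * (theta\<^sup>2 oo fps_X ^ 2)) $ n"
    by (cases "even n")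
       (auto simp: alt_theta_squared_nth numeral_fps_const fps_nth_compose_X_power theta_squared_nth_double elim!: evenE)
qed

text \<open>
  The product \<open>\<phi>(q)\<phi>(-q)\<close> is even in \<open>q\<close>. At the exponent \<open>2m = x\<^sup>2 + y\<^sup>2\<close> all signs agree, since both
  entries are even exactly if \<open>m\<close> is even, and the count is the one for \<open>m\<close>.
\<close>

lemma theta_mult_alt_theta:
  "theta * alt_theta = (alt_theta :: 'a::comm_ring_1 fps)\<^sup>2 oo fps_X ^ 2"
proof (rule fps_ext)
  fix n
  show "(theta * alt_theta :: 'a fps) $ n = (alt_theta\<^sup>2 oo fps_X ^ 2) $ n"
  proof (cases "even n")
    case True
    then obtain m where m: "n = 2 * m" by (elim evenE)
    have "theta $ i * alt_theta $ (n - i) = (-1) ^ m * (theta $ i * (theta $ (n - i) :: 'a))"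
      if "i \<in> {0..n}" for i
    proof (cases "(\<exists>x. i = x\<^sup>2) \<and> (\<exists>y. n - i = y\<^sup>2)")
      case True
      then obtain x y where xy: "i = x\<^sup>2" "n - i = y\<^sup>2" by blast
      then have n: "x\<^sup>2 + y\<^sup>2 = 2 * m" using that m by auto
      \<comment> \<open>A sum of two even squares is 0 modulo 4 and a sum of two odd squares is 2 modulo 4.\<close>
      have "even (n - i) = even m"
      proof -
        have "even (x\<^sup>2 + y\<^sup>2)" using n by simp
        then have "even x = even y" by simp
        then consider a b where "x = 2 * a" "y = 2 * b" | a b where "x = 2 * a + 1" "y = 2 * b + 1"
          by (metis evenE oddE)
        then show ?thesis
        proof cases
          case 1
          then have "m = 2 * (a\<^sup>2 + b\<^sup>2)" using n by (simp add: power2_eq_square)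
          then show ?thesis using 1 xy by simp
        next
          case 2
          then have "m = 2 * (a\<^sup>2 + a + b\<^sup>2 + b) + 1" using n by (simp add: power2_eq_square algebra_simps)
          then show ?thesis using 2 xy by simp
        qed
      qed
      then have "(-1::'a) ^ (n - i) = (-1) ^ m" by (simp add: minus_one_power_iff)
      then show ?thesis by (simp add: alt_theta_def)
    next
      case False
      then have "theta $ i = (0::'a) \<or> theta $ (n - i) = (0::'a)" by (metis theta_nth_nonsquare)
      then show ?thesis by (auto simp: alt_theta_def)
    qed
    then have "(theta * alt_theta :: 'a fps) $ n = (-1) ^ m * theta\<^sup>2 $ n"
      by (simp add: fps_mult_nth power2_eq_square[of "theta :: 'a fps"] sum_distrib_left)
    then show ?thesis
      using True by (simp add: m theta_squared_nth_double alt_theta_squared_nth fps_nth_compose_X_power)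
  next
    case False
    \<comment> \<open>For odd exponents: \<open>\<phi>(q)\<phi>(-q) = P\<^sup>2 - Q\<^sup>2\<close> with the even part \<open>P\<close> and the odd part \<open>Q\<close> of \<open>\<phi>\<close>.\<close>
    define P where "P = Abs_fps (\<lambda>n. if even n then theta $ n else (0::'a))"
    define Q where "Q = Abs_fps (\<lambda>n. if odd n then theta $ n else (0::'a))"
    have 1: "theta = P + Q" "alt_theta = P - Q"
      by (rule fps_ext; simp add: P_def Q_def alt_theta_def)+
    have "(P * P) $ n = 0" "(Q * Q) $ n = 0"
      using False by (auto simp: P_def Q_def fps_mult_nth intro!: sum.neutral)
    then have "(theta * alt_theta) $ n = (0::'a)"
      unfolding 1 by (simp add: algebra_simps)
    then show ?thesis using False by (simp add: fps_nth_compose_X_power)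
  qed
qed

section \<open>Cubes and sections of power series modulo 3\<close>

text \<open>
  Frobenius: cubing is additive in characteristic 3 and fixes every element of the prime field. Additivity is
  iterated along the coefficients by splitting off the constant term, \<open>f = c + q g\<close>.
\<close>

lemma fps_gf3_cube: "(f :: gf3 fps) ^ 3 = f oo fps_X ^ 3"
proof -
  have cube_add: "(a + b) ^ 3 = a ^ 3 + b ^ 3" for a b :: "gf3 fps"
  proof -
    have "(a + b) ^ 3 = a ^ 3 + b ^ 3 + 3 * (a * b * (a + b))"
      by (simp add: power3_eq_cube algebra_simps)
    then show ?thesis by (simp add: numeral_fps_const gf3_three)
  qed
  have "(f ^ 3) $ n = (if 3 dvd n then f $ (n div 3) else 0)" for n and f :: "gf3 fps"
  proof (induction n arbitrary: f rule: less_induct)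
    case (less n)
    define g where "g = fps_shift 1 f"
    have f: "f = fps_const (f $ 0) + fps_X * g"
      by (rule fps_ext) (simp add: g_def fps_nth_fps_const)
    have "f ^ 3 = fps_const (f $ 0) + fps_X ^ 3 * g ^ 3"
      by (subst f) (simp add: cube_add power_mult_distrib fps_const_power gf3_cube)
    then have eq: "(f ^ 3) $ n = (if n = 0 then f $ 0 else 0) + (if n < 3 then 0 else (g ^ 3) $ (n - 3))"
      by (simp add: fps_X_power_mult_nth)
    show ?case
    proof (cases "n < 3")
      case True
      then have "3 dvd n \<longleftrightarrow> n = 0" by (auto dest: dvd_imp_le)
      then show ?thesis unfolding eq using True by simp
    next
      case False
      then obtain k where k: "n = k + 3" by (metis add.commute le_Suc_ex not_less)
      show ?thesis unfolding eq using less.IH[of k g] False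
        by (simp add: k g_def fps_shift_nth)
    qed
  qed
  then show ?thesis by (intro fps_ext) (simp add: fps_nth_compose_X_power)
qed

text \<open>
  The subseries of the exponents congruent to \<open>j\<close> modulo \<open>m\<close>, renumbered. For \<open>j = 0\<close> this is the
  operator \<open>U\<^sub>m\<close> of the theory of modular forms.
\<close>

definition fps_section :: "nat \<Rightarrow> nat \<Rightarrow> 'a::comm_ring_1 fps \<Rightarrow> 'a fps" where
  "fps_section m j f = Abs_fps (\<lambda>n. f $ (m * n + j))"

lemma fps_section_add: "fps_section m j (f + g) = fps_section m j f + fps_section m j g"
  by (simp add: fps_section_def fps_eq_iff)

text \<open>
  A series in \<open>q\<^sup>m\<close> does not move exponents between residue classes, so it factors out of a section.
\<close>

lemma fps_section_mult_compose:
  assumes "j < m"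
  shows "fps_section m j ((f oo fps_X ^ m) * g) = f * fps_section m j g"
proof (rule fps_ext)
  fix n
  have m: "0 < m" using assms by simp
  let ?h = "\<lambda>i. (f oo fps_X ^ m) $ i * g $ (m * n + j - i)"
  have "(\<Sum>i=0..m * n + j. ?h i) = sum ?h ((*) m ` {0..n})"
  proof (rule sum.mono_neutral_right)
    show "(*) m ` {0..n} \<subseteq> {0..m * n + j}" by (auto simp: trans_le_add1)
    show "\<forall>i\<in>{0..m * n + j} - (*) m ` {0..n}. ?h i = 0"
    proof
      fix i assume i: "i \<in> {0..m * n + j} - (*) m ` {0..n}"
      have "\<not> m dvd i"
      proof
        assume "m dvd i"
        then obtain k where k: "i = m * k" by (elim dvdE)
        then have "m * k < m * Suc n" using i assms by simp
        then have "k \<le> n" by (metis mult_less_cancel1 less_Suc_eq_le)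
        then show False using i k by auto
      qed
      then show "?h i = 0" using m by (simp add: fps_nth_compose_X_power)
    qed
  qed simp
  also have "\<dots> = (\<Sum>i=0..n. f $ i * g $ (m * (n - i) + j))"
  proof (subst sum.reindex)
    show "inj_on ((*) m) {0..n}" using m by (auto simp: inj_on_def)
    show "sum (?h \<circ> (*) m) {0..n} = (\<Sum>i=0..n. f $ i * g $ (m * (n - i) + j))"
      using m by (intro sum.cong) (auto simp: fps_nth_compose_X_power diff_mult_distrib2)
  qed
  finally show "fps_section m j ((f oo fps_X ^ m) * g) $ n = (f * fps_section m j g) $ n"
    by (simp add: fps_section_def fps_mult_nth)
qed

lemma fps_section_cube_mult:
  assumes "j < 3" shows "fps_section 3 j (f ^ 3 * g) = f * fps_section 3 j (g :: gf3 fps)"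
  using assms by (simp add: fps_gf3_cube[of f] fps_section_mult_compose)

lemma gf3_fps_cube_add: "(f + g) ^ 3 = f ^ 3 + (g :: gf3 fps) ^ 3"
  by (simp add: fps_gf3_cube[of f] fps_gf3_cube[of g] fps_gf3_cube[of "f + g"] fps_compose_add_distrib)

lemma fps_gf3_three_sections:
  fixes f :: "gf3 fps"
  shows "f = fps_section 3 0 f ^ 3 + fps_X * fps_section 3 1 f ^ 3 + fps_X\<^sup>2 * fps_section 3 2 f ^ 3"
proof (rule fps_ext)
  fix n :: nat
  have "\<exists>k. n = 3 * k \<or> n = 3 * k + 1 \<or> n = 3 * k + 2" by presburger
  then obtain k where "n = 3 * k \<or> n = 3 * k + 1 \<or> n = 3 * k + 2" ..
  moreover have "\<not> 3 dvd 3 * k + 1" "\<not> 3 dvd 3 * k + 2" "0 < k \<Longrightarrow> \<not> 3 dvd 3 * k - 1"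
      "0 < k \<Longrightarrow> \<not> 3 dvd 3 * k - 2" "\<not> 3 dvd Suc (3 * k)" "\<not> 3 dvd Suc (Suc (3 * k))" "0 < k \<Longrightarrow> \<not> 3 dvd 3 * k - Suc 0"
    by presburger+
  ultimately show "f $ n = (fps_section 3 0 f ^ 3 + fps_X * fps_section 3 1 f ^ 3 + fps_X\<^sup>2 * fps_section 3 2 f ^ 3) $ n"
    unfolding fps_gf3_cube[of "fps_section _ _ _"]
    by (elim disjE; simp add: fps_nth_compose_X_power fps_X_power_mult_nth fps_section_def)
qed

section \<open>Theta series modulo 3\<close>

text \<open>
  A square divisible by 3 is divisible by 9.
\<close>

lemma theta_nth_3_mult:
  "(theta :: 'a::comm_ring_1 fps) $ (3 * n) = (if 3 dvd n then theta $ (n div 3) else 0)"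
proof (cases "\<exists>k. 3 * n = k\<^sup>2")
  case True
  then obtain k where k: "3 * n = k\<^sup>2" by blast
  then have "3 dvd k\<^sup>2" by (metis dvd_triv_left)
  then have "3 dvd k" using prime_dvd_power[of 3 k 2] by simp
  then obtain j where j: "k = 3 * j" by (elim dvdE)
  then have "n = 3 * j\<^sup>2" using k by (simp add: power2_eq_square)
  moreover have "theta $ (3 * n) = (if j = 0 then 1 else 2 :: 'a)"
    unfolding k theta_nth_square using j by simp
  ultimately show ?thesis by (simp add: theta_nth_square)
next
  case False
  have "theta $ (n div 3) = (0::'a)" if "3 dvd n"
  proof (rule theta_nth_nonsquare)
    fix j show "n div 3 \<noteq> j\<^sup>2"
    proof
      assume "n div 3 = j\<^sup>2"
      then have "3 * n = (3 * j)\<^sup>2" using that by (auto simp: power2_eq_square)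
      then show False using False by blast
    qed
  qed
  then show ?thesis using False by (simp add: theta_nth_nonsquare)
qed

lemma theta_nth_2_mod_3: "(theta :: 'a::comm_ring_1 fps) $ (3 * n + 2) = 0"
proof (rule theta_nth_nonsquare, rule notI)
  fix k assume "3 * n + 2 = k\<^sup>2"
  then have "(k mod 3)\<^sup>2 mod 3 = (3 * n + 2) mod 3" by (simp only: power_mod)
  moreover have "(3 * n + 2) mod 3 = 2" by presburger
  moreover have "k mod 3 = 0 \<or> k mod 3 = 1 \<or> k mod 3 = 2" by presburger
  ultimately show False by (elim disjE) simp_all
qed

text \<open>
  Of the three sections of \<open>\<phi>\<close>, the one at residue 2 vanishes and the one at residue 0 is \<open>\<phi>(q\<^sup>3)\<close>, the
  cube of \<open>\<phi>\<close>.
\<close>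

lemma theta_dissection:
  "theta = (theta ^ 3) ^ 3 + fps_X * fps_section 3 1 (theta :: gf3 fps) ^ 3"
proof -
  have "fps_section 3 0 theta = (theta :: gf3 fps) ^ 3"
    unfolding fps_gf3_cube[of theta]
    by (rule fps_ext) (simp add: fps_section_def theta_nth_3_mult fps_nth_compose_X_power)
  moreover have "fps_section 3 2 theta = (0 :: gf3 fps)"
    by (rule fps_ext) (simp add: fps_section_def theta_nth_2_mod_3 del: add_2_eq_Suc')
  ultimately show ?thesis
    by (intro trans[OF fps_gf3_three_sections[of theta]]) simp
qed

lemma alt_theta_dissection:
  "alt_theta = (alt_theta ^ 3) ^ 3 + fps_X * fps_section 3 1 (alt_theta :: gf3 fps) ^ 3"
proof -
  have "fps_section 3 0 alt_theta = (alt_theta :: gf3 fps) ^ 3"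
    unfolding fps_gf3_cube[of alt_theta]
    by (rule fps_ext)
       (auto simp: fps_section_def alt_theta_def theta_nth_3_mult fps_nth_compose_X_power minus_one_power_iff)
  moreover have "fps_section 3 2 alt_theta = (0 :: gf3 fps)"
    by (rule fps_ext) (simp add: fps_section_def alt_theta_def theta_nth_2_mod_3 del: add_2_eq_Suc')
  ultimately show ?thesis
    by (intro trans[OF fps_gf3_three_sections[of alt_theta]]) simp
qed

lemma theta_nth_0: "theta $ 0 = 1" "alt_theta $ 0 = 1"
  using theta_nth_square[of 0] by (simp_all add: alt_theta_def)

lemma fps_gf3_three: "(3 :: gf3 fps) = 0"
  by (simp add: numeral_fps_const gf3_three)

text \<open>
  The relations between sums of two squares express \<open>s = \<phi>(q)\<^sup>4 + \<phi>(-q)\<^sup>4\<close> through the same theta series at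
  \<open>q\<^sup>2\<close>, and modulo 3 the expression is \<open>s(q\<^sup>2)\<close> itself. Then a coefficient at \<open>n > 0\<close> equals the one at
  \<open>n/2\<close>, or 0 for odd \<open>n\<close>, and descent leaves the constant term 2.
\<close>

lemma theta_4_add_alt_theta_4: "theta ^ 4 + alt_theta ^ 4 = (2 :: gf3 fps)"
proof -
  define s where "s = (theta ^ 4 + alt_theta ^ 4 :: gf3 fps)"
  define U where "U = ((theta :: gf3 fps)\<^sup>2 oo fps_X ^ 2)"
  define V where "V = ((alt_theta :: gf3 fps)\<^sup>2 oo fps_X ^ 2)"
  have "s = (theta\<^sup>2 + alt_theta\<^sup>2)\<^sup>2 - 2 * (theta * alt_theta)\<^sup>2"
    unfolding s_def by (simp add: power2_eq_square power4_eq_xxxx algebra_simps)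
  also have "\<dots> = (2 * U)\<^sup>2 - 2 * V\<^sup>2"
    unfolding U_def V_def theta_squared_add_alt_theta_squared theta_mult_alt_theta ..
  also have "\<dots> = U\<^sup>2 + V\<^sup>2 + 3 * (U\<^sup>2 - V\<^sup>2)"
    by (simp add: power2_eq_square algebra_simps)
  also have "\<dots> = U\<^sup>2 + V\<^sup>2" by (simp add: fps_gf3_three)
  also have "\<dots> = s oo fps_X ^ 2"
    by (simp add: U_def V_def s_def fps_compose_add_distrib fps_compose_power flip: power_mult)
  finally have s: "s = s oo fps_X ^ 2" .
  have "s $ n = 0" if "0 < n" for n
    using that
  proof (induction n rule: less_induct)
    case (less n)
    have "s $ n = (if even n then s $ (n div 2) else 0)"
      by (subst s) (simp add: fps_nth_compose_X_power)
    then show ?case using less by (auto elim!: evenE)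
  qed
  moreover have "s $ 0 = 2" by (simp add: s_def fps_nth_power_0 theta_nth_0)
  ultimately have "s $ n = 2 $ n" for n by (cases "n = 0") (simp_all add: numeral_fps_const)
  then show ?thesis unfolding s_def[symmetric] by (rule fps_ext)
qed

text \<open>
  It suffices to prove the cube of the relation, multiplied by \<open>q\<close>. There the dissections replace \<open>q a\<^sup>3\<close> and
  \<open>q b\<^sup>3\<close>, and what remains is \<open>s - s\<^sup>3\<close> for the constant \<open>s = 2\<close>, which is
  \<open>-6\<close> and vanishes in characteristic 3.
\<close>

lemma theta_section_antisymmetry:
  "fps_section 3 1 theta * theta = - (fps_section 3 1 alt_theta * (alt_theta :: gf3 fps))"
proof -
  define u where "u = (theta :: gf3 fps)"
  define v where "v = (alt_theta :: gf3 fps)"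
  define a where "a = fps_section 3 1 u"
  define b where "b = fps_section 3 1 v"
  have "u = (u ^ 3) ^ 3 + fps_X * a ^ 3"
    unfolding u_def a_def by (rule theta_dissection)
  then have u: "fps_X * a ^ 3 = u - (u ^ 3) ^ 3" by (metis add_diff_cancel_left')
  have "v = (v ^ 3) ^ 3 + fps_X * b ^ 3"
    unfolding v_def b_def by (rule alt_theta_dissection)
  then have v: "fps_X * b ^ 3 = v - (v ^ 3) ^ 3" by (metis add_diff_cancel_left')
  have s: "u ^ 4 + v ^ 4 = 2" unfolding u_def v_def by (rule theta_4_add_alt_theta_4)
  have "fps_X * (a * u + b * v) ^ 3 = (fps_X * a ^ 3) * u ^ 3 + (fps_X * b ^ 3) * v ^ 3"
    by (simp add: gf3_fps_cube_add power_mult_distrib algebra_simps)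
  also have "\<dots> = (u ^ 4 + v ^ 4) - ((u ^ 4) ^ 3 + (v ^ 4) ^ 3)"
    unfolding u v by (simp add: algebra_simps flip: power_mult power_add power_Suc power_Suc2)
  also have "\<dots> = 2 - 2 ^ 3" unfolding gf3_fps_cube_add[symmetric] s ..
  also have "\<dots> = - (2 * 3)" by simp
  also have "\<dots> = 0" by (simp only: fps_gf3_three) simp
  finally have "a * u + b * v = 0" by simp
  then show ?thesis unfolding a_def b_def u_def v_def by (simp add: eq_neg_iff_add_eq_0)
qed

text \<open>
  Modulo 3 the factors at \<open>q\<^sup>3\<close> and \<open>q\<^sup>6\<close> are the cubes of those at \<open>q\<close> and \<open>q\<^sup>2\<close>. Cancelling leaves
  \<open>\<phi>(-q)\<^sup>2/\<phi>(-q\<^sup>2)\<^sup>2\<close>, and \<open>\<phi>(q)\<phi>(-q) = \<phi>(-q\<^sup>2)\<^sup>2\<close> finishes.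
\<close>

lemma Rbar_fps_2_3_mult_theta: "Rbar_fps 2 3 * theta = (alt_theta :: gf3 fps)"
proof -
  let ?v = "alt_theta :: gf3 fps"
  define w where "w = ?v oo fps_X ^ 2"
  have 6: "?v oo fps_X ^ 6 = w ^ 3"
  proof (rule fps_ext)
    fix n :: nat
    have "6 dvd n \<longleftrightarrow> 3 dvd n \<and> 2 dvd n div 3" by presburger
    then show "(?v oo fps_X ^ 6) $ n = (w ^ 3) $ n"
      unfolding fps_gf3_cube[of w]
      by (simp add: w_def fps_nth_compose_X_power flip: div_mult2_eq)
  qed
  have w2: "theta * ?v = w\<^sup>2"
    by (simp add: theta_mult_alt_theta w_def fps_compose_power)
  have "?v $ 0 \<noteq> 0" "w $ 0 \<noteq> 0" by (simp_all add: w_def theta_nth_0)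
  then have nz: "?v \<noteq> 0" "w \<noteq> 0" by auto
  have "Rbar_fps 2 3 * (?v * w ^ 3) = w * ?v ^ 3"
    using Rbar_fps_2_3[where 'a = gf3] unfolding 6 w_def[symmetric] fps_gf3_cube[of ?v, symmetric] .
  then have "(?v * w) * (Rbar_fps 2 3 * w\<^sup>2) = (?v * w) * ?v\<^sup>2"
    by (simp add: power2_eq_square power3_eq_cube mult_ac)
  then have "Rbar_fps 2 3 * w\<^sup>2 = ?v\<^sup>2" using nz by simp
  then have "?v * (Rbar_fps 2 3 * theta) = ?v * ?v"
    by (simp only: w2[symmetric] power2_eq_square[of ?v] mult_ac)
  then show ?thesis using nz(1) by (metis mult_left_cancel)
qed

section \<open>The vanishing coefficients\<close>

text \<open>
  The expansion of the square, arranged as a combination of \<open>1\<close>, \<open>q\<close>, \<open>q\<^sup>2\<close> with cubes as coefficients, from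
  which sections can be read off. The 2 of the cross term can go inside the cube because \<open>2\<^sup>3 = 2\<close> in
  characteristic 3.
\<close>

lemma square_of_dissection:
  assumes "w = (w ^ 3) ^ 3 + fps_X * (c :: gf3 fps) ^ 3"
  shows "w\<^sup>2 = ((w\<^sup>2) ^ 3) ^ 3 + (2 * w ^ 3 * c) ^ 3 * fps_X + (c\<^sup>2) ^ 3 * fps_X\<^sup>2"
proof -
  have two: "(2 :: gf3 fps) ^ 3 = 2"
  proof -
    have "(2 :: gf3 fps) ^ 3 = 2 + 2 * 3" by simp
    then show ?thesis by (simp only: fps_gf3_three) simp
  qed
  define z where "z = (w ^ 3) ^ 3"
  have "w\<^sup>2 = (z + fps_X * c ^ 3)\<^sup>2" using assms by (simp add: z_def)
  also have "\<dots> = z\<^sup>2 + 2 * z * c ^ 3 * fps_X + (c\<^sup>2) ^ 3 * fps_X\<^sup>2"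
    by (simp add: power2_eq_square power3_eq_cube algebra_simps)
  also have "z\<^sup>2 = ((w\<^sup>2) ^ 3) ^ 3" by (simp add: z_def flip: power_mult)
  also have "2 * z * c ^ 3 = (2 * w ^ 3 * c) ^ 3" by (simp only: power_mult_distrib two z_def)
  finally show ?thesis .
qed

lemma fps_section_3_monomials:
  "fps_section 3 0 1 = (1 :: gf3 fps)" "fps_section 3 0 fps_X = (0 :: gf3 fps)"
  "fps_section 3 0 (fps_X\<^sup>2) = (0 :: gf3 fps)" "fps_section 3 2 1 = (0 :: gf3 fps)"
  "fps_section 3 2 fps_X = (0 :: gf3 fps)" "fps_section 3 2 (fps_X\<^sup>2) = (1 :: gf3 fps)"
  by (rule fps_ext; auto simp: fps_section_def fps_X_power_nth; presburger)+

lemma fps_section_3_components: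
  fixes p q r :: "gf3 fps"
  assumes "j < 3"
  shows "fps_section 3 j (p ^ 3 + q ^ 3 * fps_X + r ^ 3 * fps_X\<^sup>2) =
           p * fps_section 3 j 1 + q * fps_section 3 j fps_X + r * fps_section 3 j (fps_X\<^sup>2)"
  using fps_section_cube_mult[OF assms, of p 1] assms
  by (simp add: fps_section_add fps_section_cube_mult)

text \<open>
  Multiplying by a cube before taking a section only multiplies the result, so \<open>G = v/u\<close> may be replaced by
  \<open>u\<^sup>3G = v u\<^sup>2\<close>, whose sections the dissections of \<open>u\<close> and \<open>v\<close> make explicit. The section \<open>H\<close> obtained
  in this way is cleared of its denominator by \<open>(u v)\<^sup>3\<close> in the same manner. With \<open>K = a u = - b v\<close> the
  section of \<open>H\<close> at residue 2, multiplied by \<open>u v\<close>, consists of the two contributions \<open>v\<^sup>2K\<^sup>2\<close> and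
  \<open>2v\<^sup>2K\<^sup>2\<close>, which add up to a multiple of 3.
\<close>

lemma sections_of_quotient_eq_0:
  fixes u v a b G :: "gf3 fps"
  assumes u: "u = (u ^ 3) ^ 3 + fps_X * a ^ 3" and v: "v = (v ^ 3) ^ 3 + fps_X * b ^ 3"
    and ab: "a * u = - (b * v)" and G: "G * u = v" and nz: "u \<noteq> 0" "v \<noteq> 0"
  shows "fps_section 3 2 (fps_section 3 0 G) = 0"
proof -
  define H where "H = fps_section 3 0 G"
  define K where "K = a * u"
  have bv: "b * v = - K" using ab by (simp add: K_def)

  have "fps_section 3 0 (v * u\<^sup>2) = v ^ 3 * (u\<^sup>2) ^ 3 + b * a\<^sup>2 * fps_X"
  proof -
    have "v * u\<^sup>2 = ((v ^ 3) ^ 3 + fps_X * b ^ 3) *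
        (((u\<^sup>2) ^ 3) ^ 3 + (2 * u ^ 3 * a) ^ 3 * fps_X + (a\<^sup>2) ^ 3 * fps_X\<^sup>2)"
      by (rule arg_cong2[where f = "(*)", OF v square_of_dissection[OF u]])
    also have "\<dots> = (v ^ 3 * (u\<^sup>2) ^ 3 + b * a\<^sup>2 * fps_X) ^ 3
        + (v ^ 3 * (2 * u ^ 3 * a) + b * (u\<^sup>2) ^ 3) ^ 3 * fps_X
        + (v ^ 3 * a\<^sup>2 + b * (2 * u ^ 3 * a)) ^ 3 * fps_X\<^sup>2"
      unfolding gf3_fps_cube_add power_mult_distrib by (simp add: algebra_simps power2_eq_square power3_eq_cube)
    finally show ?thesis by (simp add: fps_section_3_components fps_section_3_monomials)
  qed
  moreover have "fps_section 3 0 (v * u\<^sup>2) = H * u"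
  proof -
    have "u ^ 3 * G = v * u\<^sup>2" by (simp add: G[symmetric] power2_eq_square power3_eq_cube mult_ac)
    then show ?thesis
      using fps_section_cube_mult[of 0 u G] by (simp add: H_def mult.commute)
  qed
  ultimately have H: "H * u = v ^ 3 * (u\<^sup>2) ^ 3 + b * a\<^sup>2 * fps_X" by simp

  have section_cube_mult: "fps_section 3 2 (f ^ 3 * g) = f * fps_section 3 2 g" for f g :: "gf3 fps"
    by (rule fps_section_cube_mult) simp
  have "(u * v) ^ 3 * H = (H * u) * (u\<^sup>2 * v ^ 3)"
    by (simp add: power2_eq_square power3_eq_cube mult_ac)
  also have "\<dots> = ((v * u)\<^sup>2) ^ 3 * u\<^sup>2 + (a * u)\<^sup>2 * (b * v) * (fps_X * v\<^sup>2)"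
    unfolding H by (simp add: power2_eq_square power3_eq_cube algebra_simps)
  also have "(a * u)\<^sup>2 * (b * v) = (- K) ^ 3"
    unfolding bv K_def[symmetric] by (simp add: power2_eq_square power3_eq_cube)
  finally have "fps_section 3 2 ((u * v) ^ 3 * H) =
      fps_section 3 2 (((v * u)\<^sup>2) ^ 3 * u\<^sup>2) + fps_section 3 2 ((- K) ^ 3 * (fps_X * v\<^sup>2))"
    by (simp only: fps_section_add)
  then have "u * v * fps_section 3 2 H =
      (v * u)\<^sup>2 * fps_section 3 2 (u\<^sup>2) - K * fps_section 3 2 (fps_X * v\<^sup>2)"
    by (simp only: section_cube_mult) simp
  also have "fps_section 3 2 (u\<^sup>2) = a\<^sup>2"
    by (subst square_of_dissection[OF u], subst fps_section_3_components) (simp_all add: fps_section_3_monomials)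
  also have "fps_section 3 2 (fps_X * v\<^sup>2) = 2 * v ^ 3 * b"
  proof -
    have "fps_X * v\<^sup>2 = (b\<^sup>2 * fps_X) ^ 3 + ((v\<^sup>2) ^ 3) ^ 3 * fps_X + (2 * v ^ 3 * b) ^ 3 * fps_X\<^sup>2"
      by (subst square_of_dissection[OF v]) (simp add: algebra_simps power2_eq_square power3_eq_cube)
    then show ?thesis by (simp only:, subst fps_section_3_components) (simp_all add: fps_section_3_monomials)
  qed
  also have "(v * u)\<^sup>2 * a\<^sup>2 - K * (2 * v ^ 3 * b) = v\<^sup>2 * (a * u)\<^sup>2 - 2 * v\<^sup>2 * K * (b * v)"
    by (simp add: power2_eq_square power3_eq_cube mult_ac)
  also have "\<dots> = 3 * (v\<^sup>2 * K\<^sup>2)"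
    unfolding bv K_def[symmetric] by (simp add: power2_eq_square algebra_simps)
  also have "\<dots> = 0" by (simp add: fps_gf3_three)
  finally have "u * v * fps_section 3 2 H = 0" .
  then show ?thesis using nz by (simp add: H_def)
qed

text \<open>
  The exponents \<open>9n + 6 = 3(3n + 2)\<close> are those of the section at 2 of the section at 0.
\<close>

lemma three_dvd_Rbar_2_3: "3 dvd Rbar 2 3 (9 * n + 6)"
proof -
  have "(theta :: gf3 fps) $ 0 \<noteq> 0" "(alt_theta :: gf3 fps) $ 0 \<noteq> 0" by (simp_all add: theta_nth_0)
  then have "(theta :: gf3 fps) \<noteq> 0" "(alt_theta :: gf3 fps) \<noteq> 0" by auto
  then have "fps_section 3 2 (fps_section 3 0 (Rbar_fps 2 3)) = (0 :: gf3 fps)"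
    by (rule sections_of_quotient_eq_0[OF theta_dissection alt_theta_dissection
          theta_section_antisymmetry Rbar_fps_2_3_mult_theta])
  then have "fps_section 3 2 (fps_section 3 0 (Rbar_fps 2 3)) $ n = (0 :: gf3)" by simp
  then have "(of_nat (Rbar 2 3 (9 * n + 6)) :: gf3) = 0"
    by (simp add: fps_section_def Rbar_fps_def algebra_simps)
  then show ?thesis by (simp only: of_nat_gf3_eq_0_iff)
qed

theorem theorem3p1:
  fixes n :: nat
  shows "[Rbar 2 3 (9 * n + 6) = 0] (mod 6)"
proof -
  have "2 dvd Rbar 2 3 (9 * n + 6)" by (rule even_Rbar) simp
  moreover have "3 dvd Rbar 2 3 (9 * n + 6)" by (rule three_dvd_Rbar_2_3)
  ultimately have "6 dvd Rbar 2 3 (9 * n + 6)" by presburger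
  then show ?thesis by (simp add: cong_0_iff)
qed

end
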